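(* For each $n=0,\dots,n_i-1$, given $\mathbf V^{(n)}\in(S_h^k)^{n_e}$, the backward Euler system $$\left(\frac{V_i^{(n+1)}-V_i^{(n)}}{\delta},W_i\right)+b_2^{(n+1)}a_i^{(n+1)}\left(\frac{\partial V_i^{(n+1)}}{\partial y},\frac{\partial W_i}{\partial y}\right)-\left(b_1^{(n+1)}\frac{\partial V_i^{(n+1)}}{\partial y},W_i\right)=(g_i^{(n+1)},W_i)$$ for all $W_i\in S_h^k$, $i=1,\dots,n_e$, where $a_i^{(n+1)}=a_i\big(l^{(n+1)}(V_1^{(n+1)}),\dots,l^{(n+1)}(V_{n_e}^{(n+1)})\big)$, has a solution $\mathbf V^{(n+1)}=(V_1^{(n+1)},\dots,V_{n_e}^{(n+1)})\in(S_h^k)^{n_e}$.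
   Context: Let $n_e\ge1$ be an integer and $T>0$. Let $\alpha,\beta\in\mathcal C^2([0,T])$ with $\alpha',\beta'\in L_2(]0,T[)$, put $\gamma=\beta-\alpha$, assume that $\gamma$ is increasing on $[0,T[$, and that $0<\gamma_0<\gamma(t)<\gamma_1<\infty$, $|\gamma'(t)|\le\gamma'_{\max}$ and $|\alpha'(t)|\le\alpha'_{\max}$ for all $t\in[0,T]$. Put $\Omega_t=]\alpha(t),\beta(t)[$ and $\Omega=]0,1[$. For $i=1,\dots,n_e$: $f_i$ satisfies $\int_0^T\int_{\Omega_t}f_i^2\,dx\,dt<\infty$; $a_i:\mathbb R^{n_e}\to\mathbb R^+$ is Lipschitz-continuous with $0<m_a\le a_i(s)\le M_a$ for all $s\in\mathbb R^{n_e}$. Notation: $b_1(y,t)=\dfrac{\alpha'(t)+\gamma'(t)y}{\gamma(t)}$, $b_2(t)=\dfrac1{\gamma(t)^2}$, $g_i(y,t)=f_i(\alpha(t)+\gamma(t)y,t)$. Time is discretised with step $\delta>0$, $t_n=n\delta$, $n=0,\dots,n_i$, $T=n_i\delta$; a superscript $(n)$ on a given function denotes its value at $t_n$, so $b_1^{(n)}=b_1(\cdot,t_n)$, $b_2^{(n)}=b_2(t_n)$, $g_i^{(n)}=g_i(\cdot,t_n)$ (assumed to be in $L_2(\Omega)$), and $l^{(n)}(w)=\gamma(t_n)\int_0^1w(y)\,dy$. $(\cdot,\cdot)$ is the inner product of $L_2(\Omega)$. $\mathcal T_h$ is a partition of $\Omega$ into disjoint intervals of maximal length $h$; $S_h^k$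 ($k\ge1$ an integer) is the space of continuous functions on $[0,1]$ that vanish at $0$ and $1$ and are polynomials of degree $k$ on each interval of $\mathcal T_h$. *)

theory Defs
  imports "HOL-Analysis.Analysis" "HOL-Computational_Algebra.Polynomial"
begin

definition C2_on :: "real set \<Rightarrow> (real \<Rightarrow> real) \<Rightarrow> bool" where
  "C2_on S u \<longleftrightarrow>
     (\<exists>u' u''. (\<forall>t\<in>S. (u has_real_derivative u' t) (at t within S) \<and>
                      (u' has_real_derivative u'' t) (at t within S)) \<and>
              continuous_on S u'')"

definition L2_on :: "'a::euclidean_space set \<Rightarrow> ('a \<Rightarrow> real) \<Rightarrow> bool" where
  "L2_on A u \<longleftrightarrow>
     set_borel_measurable lebesgue A u \<and> set_integrable lebesgue A (\<lambda>x. (u x)\<^sup>2)"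

definition inner_L2 :: "(real \<Rightarrow> real) \<Rightarrow> (real \<Rightarrow> real) \<Rightarrow> real" where
  "inner_L2 u v = (LINT y:{0<..<1}|lebesgue. u y * v y)"

text \<open>Time derivative on \<open>[0,T]\<close>, one-sided at the two end points.\<close>

definition time_deriv :: "real \<Rightarrow> (real \<Rightarrow> real) \<Rightarrow> real \<Rightarrow> real" where
  "time_deriv T u t = vector_derivative u (at t within {0..T})"

definition b1 :: "real \<Rightarrow> (real \<Rightarrow> real) \<Rightarrow> (real \<Rightarrow> real) \<Rightarrow> real \<Rightarrow> real \<Rightarrow> real" where
  "b1 T \<alpha> \<gamma> y t = (time_deriv T \<alpha> t + time_deriv T \<gamma> t * y) / \<gamma> t"

definition b2 :: "(real \<Rightarrow> real) \<Rightarrow> real \<Rightarrow> real" where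
  "b2 \<gamma> t = 1 / (\<gamma> t)\<^sup>2"

definition pull_back ::
  "(real \<Rightarrow> real) \<Rightarrow> (real \<Rightarrow> real) \<Rightarrow> (real \<Rightarrow> real \<Rightarrow> real) \<Rightarrow> real \<Rightarrow> real \<Rightarrow> real" where
  "pull_back \<alpha> \<gamma> f y t = f (\<alpha> t + \<gamma> t * y) t"

definition nonlocal_l :: "(real \<Rightarrow> real) \<Rightarrow> real \<Rightarrow> (real \<Rightarrow> real) \<Rightarrow> real" where
  "nonlocal_l \<gamma> t w = \<gamma> t * (LINT y:{0..1}|lebesgue. w y)"

text \<open>The mesh is given by the closures of its cells: a finite set of non-degenerate compact
  intervals with disjoint interiors and union \<open>[0,1]\<close>.\<close>

definition mesh :: "real set set \<Rightarrow> real \<Rightarrow> bool" where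
  "mesh \<T> h \<longleftrightarrow>
     \<T> division_of {0..1} \<and> (\<forall>K\<in>\<T>. interior K \<noteq> {}) \<and> h = Max (measure lborel ` \<T>)"

text \<open>Functions on \<open>[0,1]\<close> are represented by their extension by zero. Since members of the
  space are polynomial on each cell, \<^term>\<open>deriv V\<close> is the weak derivative of \<open>V\<close> on
  \<open>]0,1[\<close>: its unspecified values at the finitely many nodes do not affect integrals.\<close>

definition fe_space :: "real set set \<Rightarrow> nat \<Rightarrow> (real \<Rightarrow> real) set" where
  "fe_space \<T> k =
     {V. continuous_on {0..1} V \<and> V 0 = 0 \<and> V 1 = 0 \<and> (\<forall>y. y \<notin> {0..1} \<longrightarrow> V y = 0) \<and>
         (\<forall>K\<in>\<T>. \<exists>p::real poly. degree p \<le> k \<and> (\<forall>y\<in>K. V y = poly p y))}"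

end

theory Submission imports Defs begin

text \<open>Once the scalars \<open>a\<^sub>i\<close> are frozen at \<open>c \<ge> m\<^sub>a > 0\<close>, the system decouples into linear
  problems on \<open>S\<^sub>h\<^sup>k\<close>. Since \<open>b\<^sub>1\<close> is affine in \<open>y\<close> with slope \<open>q = \<gamma>'/\<gamma>\<close>, integration by parts
  turns the drift term tested with the solution into \<open>q/2\<close> times the squared norm; as \<open>\<gamma>\<close> is
  increasing, \<open>q \<ge> 0\<close>, so the linear problems are coercive for every \<open>\<delta>\<close> and uniquely solvable.
  The energy estimate for the difference of two solutions shows that the mean value of the solution
  depends continuously on \<open>c\<close>. What remains is an equation for the vector \<open>s\<close> of the \<open>n\<^sub>e\<close> numbers
  \<open>l(V\<^sub>i)\<close>. Its right-hand side is continuous in \<open>s\<close> and, the coefficients ranging over the compact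
  interval \<open>[m\<^sub>a, M\<^sub>a]\<close>, takes values in a box, so Brouwer's theorem applies.\<close>

section \<open>Linear problems with a positive form on a finitely determined function space\<close>

definition fun_subspace :: "('a \<Rightarrow> real) set \<Rightarrow> bool" where
  "fun_subspace S \<longleftrightarrow> (\<lambda>_. 0) \<in> S \<and> (\<forall>u\<in>S. \<forall>v\<in>S. \<forall>c. (\<lambda>x. u x + c * v x) \<in> S)"

text \<open>Linearity is asked for on \<open>S\<close> alone: an expression such as
  \<open>inner_L2 (deriv u) w\<close> need not be additive for arbitrary functions, where integrals
  or derivatives may fail to exist and take default values.\<close>

definition linear_on_fun :: "('a \<Rightarrow> real) set \<Rightarrow> (('a \<Rightarrow> real) \<Rightarrow> real) \<Rightarrow> bool" where
  "linear_on_fun S F \<longleftrightarrow> (\<forall>u\<in>S. \<forall>v\<in>S. \<forall>c. F (\<lambda>x. u x + c * v x) = F u + c * F v)"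

lemma fun_subspaceD:
  assumes "fun_subspace S"
  shows "(\<lambda>_. 0) \<in> S" "\<And>u v c. u \<in> S \<Longrightarrow> v \<in> S \<Longrightarrow> (\<lambda>x. u x + c * v x) \<in> S"
  using assms unfolding fun_subspace_def by blast+

lemma linear_on_funD:
  "linear_on_fun S F \<Longrightarrow> u \<in> S \<Longrightarrow> v \<in> S \<Longrightarrow> F (\<lambda>x. u x + c * v x) = F u + c * F v"
  unfolding linear_on_fun_def by blast

lemma linear_on_fun_subset: "linear_on_fun S F \<Longrightarrow> S' \<subseteq> S \<Longrightarrow> linear_on_fun S' F"
  unfolding linear_on_fun_def by blast

lemma linear_on_fun_zero:
  assumes "fun_subspace S" "linear_on_fun S F"
  shows "F (\<lambda>_. 0) = 0"
  using linear_on_funD[OF assms(2) fun_subspaceD(1)[OF assms(1)] fun_subspaceD(1)[OF assms(1)], of 1]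
  by simp

text \<open>Induction on the separating points \<open>P\<close> replaces any dimension theory: the functions of \<open>S\<close>
  vanishing at \<open>p\<close> form a subspace of codimension at most one separated by the remaining points,
  and the complement is spanned by a vector made orthogonal to that subspace.\<close>

lemma galerkin_solvable:
  assumes "finite P" "fun_subspace S"
    and sep: "\<And>u. u \<in> S \<Longrightarrow> (\<And>p. p \<in> P \<Longrightarrow> u p = 0) \<Longrightarrow> u = (\<lambda>_. 0)"
    and left: "\<And>w. w \<in> S \<Longrightarrow> linear_on_fun S (\<lambda>u. B u w)"
    and right: "\<And>u. u \<in> S \<Longrightarrow> linear_on_fun S (B u)"
    and pos: "\<And>u. u \<in> S \<Longrightarrow> u \<noteq> (\<lambda>_. 0) \<Longrightarrow> B u u > 0"
    and "linear_on_fun S F"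
  shows "\<exists>u\<in>S. \<forall>w\<in>S. B u w = F w"
  using assms
proof (induction P arbitrary: S F rule: finite_induct)
  case empty
  \<comment> \<open>Without separating points, the hypothesis of separation says that
    \<open>S\<close> is the zero space.\<close>
  have S: "w = (\<lambda>_. 0)" if "w \<in> S" for w using empty.prems(2)[OF that] by simp
  have "B (\<lambda>_. 0) (\<lambda>_. 0) = F (\<lambda>_. 0)"
    using linear_on_fun_zero[OF empty.prems(1,6)]
      linear_on_fun_zero[OF empty.prems(1) empty.prems(4)[OF fun_subspaceD(1)[OF empty.prems(1)]]]
    by simp
  with S fun_subspaceD(1)[OF empty.prems(1)] show ?case by metis
next
  case (insert p P)
  note sub = insert.prems(1) and left = insert.prems(3) and right = insert.prems(4)
  define S' where "S' = {u \<in> S. u p = 0}"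
  have S'S: "S' \<subseteq> S" by (auto simp: S'_def)
  have sub': "fun_subspace S'"
    using sub unfolding fun_subspace_def S'_def by simp
  have solve: "\<exists>u\<in>S'. \<forall>w\<in>S'. B u w = G w" if "linear_on_fun S' G" for G
  proof (rule insert.IH[OF sub'])
    show "u = (\<lambda>_. 0)" if "u \<in> S'" "\<And>x. x \<in> P \<Longrightarrow> u x = 0" for u
      using insert.prems(2)[of u] that by (auto simp: S'_def)
    show "linear_on_fun S' (\<lambda>u. B u w)" if "w \<in> S'" for w
      using linear_on_fun_subset[OF left S'S] that S'S by blast
    show "linear_on_fun S' (B u)" if "u \<in> S'" for u
      using linear_on_fun_subset[OF right S'S] that S'S by blast
    show "B u u > 0" if "u \<in> S'" "u \<noteq> (\<lambda>_. 0)" for u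
      using insert.prems(5) that S'S by blast
    show "linear_on_fun S' G" by fact
  qed
  obtain u0 where u0: "u0 \<in> S'" "\<And>w. w \<in> S' \<Longrightarrow> B u0 w = F w"
    using solve[OF linear_on_fun_subset[OF insert.prems(6) S'S]] by blast
  show ?case
  proof (cases "S = S'")
    case True
    then show ?thesis using u0 by blast
  next
    case False
    then obtain e where e: "e \<in> S" "e p \<noteq> 0" unfolding S'_def by blast
    \<comment> \<open>\<open>z\<close> is the projection of \<open>e\<close> onto \<open>S'\<close>
      with respect to \<open>B\<close>. As \<open>B\<close> need not be symmetric,
      \<open>e' = e - z\<close> is orthogonal to \<open>S'\<close> as first argument only; this is
      the slot in which it enters \<open>Bu\<close>.\<close>
    obtain z where z: "z \<in> S'" "\<And>w. w \<in> S' \<Longrightarrow> B z w = B e w"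
      using solve[OF linear_on_fun_subset[OF right[OF e(1)] S'S]] by blast
    have zS: "z \<in> S" and u0S: "u0 \<in> S" using z u0 S'S by auto
    define e' where "e' = (\<lambda>x. e x + (-1) * z x)"
    have e'S: "e' \<in> S" unfolding e'_def by (rule fun_subspaceD(2)[OF sub e(1) zS])
    have "e' p \<noteq> 0" using e z by (simp add: e'_def S'_def)
    then have "B e' e' > 0" using insert.prems(5)[OF e'S] by auto
    moreover have orth: "B e' w = 0" if "w \<in> S'" for w
      using linear_on_funD[OF left e(1) zS, of w "-1"] z(2)[OF that] that S'S
      unfolding e'_def by auto
    moreover have "B e' e' = B e' e + (-1) * B e' z"
      using linear_on_funD[OF right[OF e'S] e(1) zS, of "-1"] unfolding e'_def .
    ultimately have pos: "B e' e > 0" using z(1) by simp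
    \<comment> \<open>Chosen so that \<open>B u e = F e\<close>; the equations for test functions in
      \<open>S'\<close> are undisturbed because \<open>e'\<close> is orthogonal to them. The
      denominator equals \<open>B e' e'\<close>.\<close>
    define \<tau> where "\<tau> = (F e - B u0 e) / B e' e"
    define u where "u = (\<lambda>x. u0 x + \<tau> * e' x)"
    have uS: "u \<in> S" unfolding u_def by (rule fun_subspaceD(2)[OF sub u0S e'S])
    have Bu: "B u w = B u0 w + \<tau> * B e' w" if "w \<in> S" for w
      unfolding u_def using linear_on_funD[OF left[OF that] u0S e'S] .
    have "B u w = F w" if w: "w \<in> S" for w
    proof -
      \<comment> \<open>Splitting off a multiple of \<open>e\<close> makes \<open>w'\<close> vanish
        at \<open>p\<close>, so \<open>S'\<close> and \<open>e\<close> together exhaust the test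
        functions.\<close>
      define w' where "w' = (\<lambda>x. w x + (- (w p / e p)) * e x)"
      have w'S: "w' \<in> S" unfolding w'_def by (rule fun_subspaceD(2)[OF sub w e(1)])
      then have w': "w' \<in> S'" using e by (simp add: S'_def w'_def)
      have w_eq: "w = (\<lambda>x. w' x + (w p / e p) * e x)" by (auto simp: w'_def)
      have "B u w = B u w' + (w p / e p) * B u e"
        using linear_on_funD[OF right[OF uS] w'S e(1)] w_eq by metis
      also have "B u w' = F w'" using Bu[OF w'S] orth[OF w'] u0(2)[OF w'] by simp
      also have "B u e = F e" using Bu[OF e(1)] pos by (simp add: \<tau>_def)
      also have "F w' + (w p / e p) * F e = F w"
        using linear_on_funD[OF insert.prems(6) w'S e(1)] w_eq by metis
      finally show ?thesis .
    qed
    then show ?thesis using uS by blast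
  qed
qed

section \<open>Square-integrable functions\<close>

lemma L2_on_mult:
  assumes "L2_on A u" "L2_on A v"
  shows "set_integrable lebesgue A (\<lambda>x. u x * v x)"
proof (rule set_integrable_bound)
  show "set_integrable lebesgue A (\<lambda>x. (u x)\<^sup>2 + (v x)\<^sup>2)"
    using assms by (intro set_integral_add) (auto simp: L2_on_def)
  have "(\<lambda>x. (indicator A x *\<^sub>R u x) * (indicator A x *\<^sub>R v x)) \<in> borel_measurable lebesgue"
    using assms by (intro borel_measurable_times) (auto simp: L2_on_def set_borel_measurable_def)
  moreover have "(\<lambda>x. (indicator A x *\<^sub>R u x) * (indicator A x *\<^sub>R v x)) = (\<lambda>x. indicator A x *\<^sub>R (u x * v x))"
    by (auto simp: indicator_def)
  ultimately show "set_borel_measurable lebesgue A (\<lambda>x. u x * v x)"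
    by (simp add: set_borel_measurable_def)
  have "\<bar>u x * v x\<bar> \<le> (u x)\<^sup>2 + (v x)\<^sup>2" for x
  proof -
    have "2 * (\<bar>u x\<bar> * \<bar>v x\<bar>) \<le> (u x)\<^sup>2 + (v x)\<^sup>2"
      using sum_squares_bound[of "\<bar>u x\<bar>" "\<bar>v x\<bar>"] by (simp add: mult.assoc)
    moreover have "0 \<le> \<bar>u x\<bar> * \<bar>v x\<bar>" by simp
    ultimately show ?thesis unfolding abs_mult by linarith
  qed
  then show "AE x in lebesgue. x \<in> A \<longrightarrow> norm (u x * v x) \<le> norm ((u x)\<^sup>2 + (v x)\<^sup>2)"
    by (intro AE_I2) (metis abs_ge_self order_trans real_norm_def)
qed

lemma L2_on_lincomb:
  assumes u: "L2_on A u" and v: "L2_on A v"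
  shows "L2_on A (\<lambda>x. u x + c * v x)"
  unfolding L2_on_def
proof
  have "(\<lambda>x. (indicator A x *\<^sub>R u x) + c * (indicator A x *\<^sub>R v x)) \<in> borel_measurable lebesgue"
    using assms by (intro borel_measurable_add borel_measurable_times borel_measurable_const)
      (auto simp: L2_on_def set_borel_measurable_def)
  then show "set_borel_measurable lebesgue A (\<lambda>x. u x + c * v x)"
    by (simp add: set_borel_measurable_def algebra_simps)
  have "set_integrable lebesgue A (\<lambda>x. (u x)\<^sup>2 + ((2 * c) * (u x * v x) + c\<^sup>2 * (v x)\<^sup>2))"
    using L2_on_mult[OF u v] assms
    by (intro set_integral_add set_integrable_mult_right) (auto simp: L2_on_def)
  moreover have "(\<lambda>x. (u x + c * v x)\<^sup>2) = (\<lambda>x. (u x)\<^sup>2 + ((2 * c) * (u x * v x) + c\<^sup>2 * (v x)\<^sup>2))"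
    by (auto simp: power2_eq_square algebra_simps)
  ultimately show "set_integrable lebesgue A (\<lambda>x. (u x + c * v x)\<^sup>2)" by simp
qed

lemma L2_on_bounded_mult:
  assumes w: "set_borel_measurable lebesgue A w" and b: "\<And>x. x \<in> A \<Longrightarrow> \<bar>w x\<bar> \<le> C"
    and u: "L2_on A u"
  shows "L2_on A (\<lambda>x. w x * u x)"
  unfolding L2_on_def
proof
  have eq: "(\<lambda>x. (indicator A x *\<^sub>R w x) * (indicator A x *\<^sub>R u x)) = (\<lambda>x. indicator A x *\<^sub>R (w x * u x))"
    by (auto simp: indicator_def)
  have "(\<lambda>x. (indicator A x *\<^sub>R w x) * (indicator A x *\<^sub>R u x)) \<in> borel_measurable lebesgue"
    using w u by (intro borel_measurable_times) (auto simp: L2_on_def set_borel_measurable_def)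
  then show m: "set_borel_measurable lebesgue A (\<lambda>x. w x * u x)"
    unfolding eq set_borel_measurable_def .
  show "set_integrable lebesgue A (\<lambda>x. (w x * u x)\<^sup>2)"
  proof (rule set_integrable_bound)
    show "set_integrable lebesgue A (\<lambda>x. C\<^sup>2 * (u x)\<^sup>2)"
      using u by (intro set_integrable_mult_right) (auto simp: L2_on_def)
    have "(\<lambda>x. (indicator A x *\<^sub>R (w x * u x))\<^sup>2) = (\<lambda>x. indicator A x *\<^sub>R (w x * u x)\<^sup>2)"
      by (auto simp: indicator_def)
    then show "set_borel_measurable lebesgue A (\<lambda>x. (w x * u x)\<^sup>2)"
      using borel_measurable_power[OF m[unfolded set_borel_measurable_def], of 2]
      by (simp add: set_borel_measurable_def)
    have "(w x * u x)\<^sup>2 \<le> C\<^sup>2 * (u x)\<^sup>2" if "x \<in> A" for x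
    proof -
      have "(w x)\<^sup>2 \<le> C\<^sup>2" using b[OF that] by (auto simp: abs_le_square_iff[symmetric])
      then show ?thesis by (simp add: power_mult_distrib mult_right_mono)
    qed
    then show "AE x in lebesgue. x \<in> A \<longrightarrow> norm ((w x * u x)\<^sup>2) \<le> norm (C\<^sup>2 * (u x)\<^sup>2)"
      by (intro AE_I2) simp
  qed
qed

lemma L2_on_bounded:
  assumes A: "A \<in> lmeasurable" and u: "set_borel_measurable lebesgue A u"
    and b: "\<And>x. x \<in> A \<Longrightarrow> \<bar>u x\<bar> \<le> C"
  shows "L2_on A u"
proof -
  have "L2_on A (\<lambda>_. 1)"
    using A by (auto simp: L2_on_def set_borel_measurable_def set_integrable_def
        lmeasurable_iff_integrable)
  from L2_on_bounded_mult[OF u b this] show ?thesis by simp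
qed

text \<open>Finite sets are null. This allows \<open>deriv u\<close>, whose values at the mesh nodes
  are unspecified, to be replaced by a cellwise formula.\<close>

lemma L2_on_cong_finite:
  fixes u v :: "'a::euclidean_space \<Rightarrow> real"
  assumes "finite X" "\<And>x. x \<in> A - X \<Longrightarrow> u x = v x" "L2_on A u"
  shows "L2_on A v"
  unfolding L2_on_def
proof
  show "set_borel_measurable lebesgue A v"
    unfolding set_borel_measurable_def
    by (rule measurable_discrete_difference[where f = "\<lambda>x. indicator A x *\<^sub>R u x" and X = X])
      (use assms in \<open>auto simp: L2_on_def set_borel_measurable_def countable_finite indicator_def\<close>)
  have "integrable lebesgue (\<lambda>x. indicator A x *\<^sub>R (u x)\<^sup>2) \<longleftrightarrow>
        integrable lebesgue (\<lambda>x. indicator A x *\<^sub>R (v x)\<^sup>2)"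
    by (rule integrable_discrete_difference[where X = X])
      (use assms in \<open>auto simp: countable_finite indicator_def\<close>)
  then show "set_integrable lebesgue A (\<lambda>x. (v x)\<^sup>2)"
    using assms(3) by (simp add: set_integrable_def L2_on_def)
qed

text \<open>The domains may differ as well, so that the closed interval in \<open>nonlocal_l\<close>
  can be exchanged for the open one in \<open>inner_L2\<close>.\<close>

lemma set_lebesgue_integral_cong_finite:
  fixes u v :: "'a::euclidean_space \<Rightarrow> real"
  assumes "finite X" "\<And>x. x \<notin> X \<Longrightarrow> indicator A x * u x = indicator B x * v x"
  shows "(LINT x:A|lebesgue. u x) = (LINT x:B|lebesgue. v x)"
  unfolding set_lebesgue_integral_def
  by (rule integral_discrete_difference[where X = X])
    (use assms in \<open>auto simp: countable_finite\<close>)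

section \<open>The inner product on the unit interval\<close>

abbreviation (input) "unit_L2 \<equiv> L2_on {0<..<1::real}"

lemma inner_L2_cong_finite:
  assumes "finite X" "\<And>y. y \<in> {0<..<1} - X \<Longrightarrow> u y = u' y"
  shows "inner_L2 u v = inner_L2 u' v"
  unfolding inner_L2_def
  by (rule set_lebesgue_integral_cong_finite[OF assms(1)]) (use assms(2) in \<open>auto simp: indicator_def\<close>)

lemma inner_L2_commute: "inner_L2 u v = inner_L2 v u"
  by (simp add: inner_L2_def mult.commute)

lemma inner_L2_lincomb_left:
  assumes "unit_L2 u" "unit_L2 v" "unit_L2 w"
  shows "inner_L2 (\<lambda>y. u y + c * v y) w = inner_L2 u w + c * inner_L2 v w"
proof -
  have "inner_L2 (\<lambda>y. u y + c * v y) w = (LINT y:{0<..<1}|lebesgue. u y * w y + c * (v y * w y))"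
    by (simp add: inner_L2_def algebra_simps)
  also have "\<dots> = inner_L2 u w + (LINT y:{0<..<1}|lebesgue. c * (v y * w y))"
    unfolding inner_L2_def using assms
    by (intro set_integral_add(2) set_integrable_mult_right L2_on_mult)
  finally show ?thesis by (simp add: inner_L2_def)
qed

lemma inner_L2_lincomb_right:
  assumes "unit_L2 u" "unit_L2 v" "unit_L2 w"
  shows "inner_L2 w (\<lambda>y. u y + c * v y) = inner_L2 w u + c * inner_L2 w v"
  using inner_L2_lincomb_left[OF assms] by (simp add: inner_L2_commute)

lemma inner_L2_nonneg: "inner_L2 u u \<ge> 0"
  unfolding inner_L2_def set_lebesgue_integral_def by (intro integral_nonneg_AE AE_I2) simp

lemma inner_L2_lincomb_self:
  assumes "unit_L2 u" "unit_L2 v"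
  shows "inner_L2 (\<lambda>y. u y + c * v y) (\<lambda>y. u y + c * v y)
    = inner_L2 u u + 2 * c * inner_L2 u v + c\<^sup>2 * inner_L2 v v"
  using assms inner_L2_lincomb_left[OF assms L2_on_lincomb[OF assms, of c], of c]
    inner_L2_lincomb_right[OF assms assms(1), of c] inner_L2_lincomb_right[OF assms assms(2), of c]
  by (simp add: inner_L2_commute[of v u] power2_eq_square algebra_simps)

lemma continuous_on_unit_bounded_measurable:
  fixes w :: "real \<Rightarrow> real"
  assumes "continuous_on {0..1} w"
  obtains C where "\<And>y. y \<in> {0<..<1} \<Longrightarrow> \<bar>w y\<bar> \<le> C" "set_borel_measurable lebesgue {0<..<1} w"
proof -
  obtain C where C: "\<And>y. y \<in> {0..1} \<Longrightarrow> \<bar>w y\<bar> \<le> C"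
    using compact_continuous_image[OF assms] compact_imp_bounded bounded_iff
    by (metis compact_Icc imageI real_norm_def)
  have "set_borel_measurable borel {0<..<1} w"
    by (rule set_measurable_continuous_on) (auto intro: continuous_on_subset[OF assms])
  then have "set_borel_measurable lebesgue {0<..<1} w"
    by (auto simp: set_borel_measurable_def intro: measurable_completion)
  with C that show ?thesis by (meson atLeastAtMost_iff greaterThanLessThan_iff less_imp_le)
qed

lemma L2_on_continuous: "continuous_on {0..1} u \<Longrightarrow> unit_L2 u"
  by (erule continuous_on_unit_bounded_measurable) (rule L2_on_bounded, auto)

lemma L2_on_continuous_mult: "continuous_on {0..1} w \<Longrightarrow> unit_L2 u \<Longrightarrow> unit_L2 (\<lambda>y. w y * u y)"
  by (erule continuous_on_unit_bounded_measurable) (rule L2_on_bounded_mult)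

text \<open>Subtracting its mean \<open>m\<close> from \<open>u\<close> leaves a function of squared
  norm \<open>inner_L2 u u - m^2\<close>, because the interval has length one. This converts energy
  estimates into estimates of the mean, which is what the nonlocal coefficients see.\<close>

lemma inner_L2_one_square_le:
  assumes "unit_L2 u"
  shows "(inner_L2 u (\<lambda>_. 1))\<^sup>2 \<le> inner_L2 u u"
proof -
  let ?m = "inner_L2 u (\<lambda>_. 1)"
  have one: "unit_L2 (\<lambda>_. 1)" by (rule L2_on_continuous) simp
  have "inner_L2 (\<lambda>_. 1) (\<lambda>_. 1) = 1"
    by (simp add: inner_L2_def set_lebesgue_integral_def)
  then have "0 \<le> inner_L2 u u + 2 * (-?m) * ?m + ?m\<^sup>2"
    using inner_L2_lincomb_self[OF assms one, of "-?m"]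
      inner_L2_nonneg[of "\<lambda>y. u y + (-?m) * 1"] by simp
  then show ?thesis by (simp add: power2_eq_square)
qed

text \<open>Continuity upgrades vanishing almost everywhere to vanishing everywhere, the end points
  included; the gauge integral does not distinguish the open interval from the closed one.\<close>

lemma inner_L2_self_eq_0:
  assumes u: "continuous_on {0..1} u" and 0: "inner_L2 u u = 0" and y: "y \<in> {0..1}"
  shows "u y = 0"
proof -
  have "inner_L2 u u = integral {0<..<1} (\<lambda>y. u y * u y)"
    unfolding inner_L2_def
    by (intro set_lebesgue_integral_eq_integral L2_on_mult L2_on_continuous u)
  also have "\<dots> = integral {0..1} (\<lambda>y. u y * u y)"
    using integral_open_interval_real[of 0 1 "\<lambda>y. u y * u y"] by simp
  finally have "\<forall>y\<in>{0..1}. u y * u y = 0"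
    using integral_eq_0_iff[of 0 1 "\<lambda>y. u y * u y"] 0 u by (simp add: continuous_on_mult)
  then show ?thesis using y by simp
qed

section \<open>The finite element space and its derivatives\<close>

definition mesh_nodes :: "real set set \<Rightarrow> real set" where
  "mesh_nodes \<T> = {0..1} - (\<Union>K\<in>\<T>. interior K)"

text \<open>A node lies in a closed cell but in no open one, hence is an end point of one of
  finitely many cells. Off this set, members of the space agree locally with a polynomial.\<close>

lemma finite_mesh_nodes:
  assumes "mesh \<T> h"
  shows "finite (mesh_nodes \<T>)"
proof -
  have div: "\<T> division_of {0..1}" using assms by (simp add: mesh_def)
  have "finite (K - interior K)" if "K \<in> \<T>" for K
  proof -
    obtain a b where "K = cbox a b" using division_ofD(4)[OF div \<open>K \<in> \<T>\<close>] by blast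
    then have "K - interior K \<subseteq> {a, b}" by auto
    then show ?thesis using finite_subset by blast
  qed
  moreover have "mesh_nodes \<T> \<subseteq> (\<Union>K\<in>\<T>. K - interior K)"
    using division_ofD(6)[OF div] by (auto simp: mesh_nodes_def)
  ultimately show ?thesis using division_ofD(1)[OF div] by (meson finite_UN finite_subset)
qed

lemma mesh_cell:
  assumes "mesh \<T> h" "y \<in> {0<..<1} - mesh_nodes \<T>"
  obtains K where "K \<in> \<T>" "y \<in> interior K"
  using assms by (auto simp: mesh_nodes_def)

lemma fun_subspace_fe_space: "fun_subspace (fe_space \<T> k)"
  unfolding fun_subspace_def
proof (intro conjI ballI allI)
  show "(\<lambda>_. 0) \<in> fe_space \<T> k"
    by (auto simp: fe_space_def intro!: exI[of _ 0])
  fix u v c assume u: "u \<in> fe_space \<T> k" and v: "v \<in> fe_space \<T> k"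
  have "\<exists>p. degree p \<le> k \<and> (\<forall>y\<in>K. u y + c * v y = poly p y)" if K: "K \<in> \<T>" for K
  proof -
    obtain p where p: "degree p \<le> k" "\<forall>y\<in>K. u y = poly p y"
      using u K unfolding fe_space_def by blast
    obtain q where q: "degree q \<le> k" "\<forall>y\<in>K. v y = poly q y"
      using v K unfolding fe_space_def by blast
    show ?thesis using p q
      by (intro exI[of _ "p + smult c q"]) (auto intro!: degree_add_le degree_smult_le[THEN order_trans])
  qed
  then show "(\<lambda>x. u x + c * v x) \<in> fe_space \<T> k"
    using u v by (auto simp: fe_space_def intro!: continuous_intros)
qed

text \<open>In each cell \<open>k + 1\<close> points suffice, since a nonzero polynomial of degree
  at most \<open>k\<close> has at most \<open>k\<close> roots; a cell has enough points because its
  interior is nonempty. The set \<open>P\<close> is the input of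
  \<open>galerkin_solvable\<close>.\<close>

lemma fe_space_separating_points:
  assumes "mesh \<T> h"
  obtains P where "finite P"
    "\<And>u. u \<in> fe_space \<T> k \<Longrightarrow> (\<And>y. y \<in> P \<Longrightarrow> u y = 0) \<Longrightarrow> u = (\<lambda>_. 0)"
proof -
  have div: "\<T> division_of {0..1}" using assms by (simp add: mesh_def)
  have "\<exists>Q. Q \<subseteq> K \<and> finite Q \<and> card Q = Suc k" if "K \<in> \<T>" for K
  proof -
    have "infinite (interior K)"
      using assms that by (metis finite_imp_not_open mesh_def open_interior)
    then have "infinite K" using finite_subset interior_subset by blast
    then show ?thesis by (meson infinite_arbitrarily_large)
  qed
  then obtain Q where Q: "\<And>K. K \<in> \<T> \<Longrightarrow> Q K \<subseteq> K \<and> finite (Q K) \<and> card (Q K) = Suc k"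
    by metis
  show thesis
  proof
    show "finite (\<Union>K\<in>\<T>. Q K)" using Q division_ofD(1)[OF div] by blast
    fix u assume u: "u \<in> fe_space \<T> k" and 0: "\<And>y. y \<in> (\<Union>K\<in>\<T>. Q K) \<Longrightarrow> u y = 0"
    have "u y = 0" if K: "K \<in> \<T>" "y \<in> K" for K y
    proof -
      obtain p where p: "degree p \<le> k" "\<And>y. y \<in> K \<Longrightarrow> u y = poly p y"
        using u K unfolding fe_space_def by blast
      have "Q K \<subseteq> {x. poly p x = 0}" using 0 p Q K by fastforce
      then have "p = 0"
        using card_poly_roots_bound[of p] card_mono[OF poly_roots_finite[of p], of "Q K"] Q[OF K(1)] p(1)
        by linarith
      then show ?thesis using p(2) K by simp
    qed
    moreover have "u y = 0" if "y \<notin> {0..1}" for y using u that by (simp add: fe_space_def)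
    ultimately show "u = (\<lambda>_. 0)" using division_ofD(6)[OF div] by blast
  qed
qed

lemma fe_space_continuous: "u \<in> fe_space \<T> k \<Longrightarrow> continuous_on {0..1} u"
  by (simp add: fe_space_def)

lemma fe_space_L2: "u \<in> fe_space \<T> k \<Longrightarrow> unit_L2 u"
  by (intro L2_on_continuous fe_space_continuous)

lemma fe_space_DERIV_poly:
  assumes "y \<in> interior K" "\<And>y. y \<in> K \<Longrightarrow> u y = poly p y"
  shows "(u has_real_derivative poly (pderiv p) y) (at y)"
  by (rule has_field_derivative_transform_within_open[OF poly_DERIV open_interior assms(1)])
    (use assms(2) interior_subset in fastforce)

lemma fe_space_DERIV:
  assumes "mesh \<T> h" "u \<in> fe_space \<T> k" "y \<in> {0<..<1} - mesh_nodes \<T>"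
  shows "(u has_real_derivative deriv u y) (at y)"
proof -
  obtain K where K: "K \<in> \<T>" "y \<in> interior K" using mesh_cell assms by blast
  obtain p where "\<And>y. y \<in> K \<Longrightarrow> u y = poly p y"
    using assms(2) K unfolding fe_space_def by blast
  from fe_space_DERIV_poly[OF K(2) this] show ?thesis using DERIV_imp_deriv by fastforce
qed

text \<open>Off the nodes the derivative is a finite sum of polynomials cut off to the open cells,
  each of them bounded on the unit interval.\<close>

lemma fe_space_deriv_L2:
  assumes "mesh \<T> h" "u \<in> fe_space \<T> k"
  shows "unit_L2 (deriv u)"
proof -
  have div: "\<T> division_of {0..1}" using assms by (simp add: mesh_def)
  obtain p where p: "\<And>K y. K \<in> \<T> \<Longrightarrow> y \<in> K \<Longrightarrow> u y = poly (p K) y"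
    using assms(2) unfolding fe_space_def by (auto dest!: bchoice)
  let ?v = "\<lambda>F y. \<Sum>K\<in>F. indicator (interior K) y * poly (pderiv (p K)) y"
  have summand: "unit_L2 (\<lambda>y. indicator (interior K) y * poly (pderiv (p K)) y)" for K
  proof (rule L2_on_bounded_mult)
    show "unit_L2 (poly (pderiv (p K)))" by (intro L2_on_continuous continuous_intros)
    show "\<bar>indicator (interior K) x\<bar> \<le> (1::real)" for x by (simp add: indicator_def)
    have "(\<lambda>x. indicator ({0<..<1} \<inter> interior K) x :: real) \<in> borel_measurable lebesgue"
      by (intro borel_measurable_indicator) (auto simp: borel_open)
    then show "set_borel_measurable lebesgue {0<..<1} (indicator (interior K) :: real \<Rightarrow> real)"
      by (simp add: set_borel_measurable_def indicator_inter_arith)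
  qed
  have "unit_L2 (?v F)" if "finite F" for F
    using that
  proof (induction F)
    case empty
    show ?case by (simp add: L2_on_continuous)
  next
    case (insert K F)
    then show ?case
      using L2_on_lincomb[OF summand insert.IH, of K 1]
      by (simp only: sum.insert[OF insert.hyps] mult_1_left)
  qed
  then have "unit_L2 (?v \<T>)" using division_ofD(1)[OF div] .
  moreover have "?v \<T> y = deriv u y" if y: "y \<in> {0<..<1} - mesh_nodes \<T>" for y
  proof -
    obtain K where K: "K \<in> \<T>" "y \<in> interior K" using mesh_cell[OF assms(1) y] by blast
    \<comment> \<open>The open cells are disjoint, so exactly one summand survives at
      \<open>y\<close>.\<close>
    have "?v \<T> y = (\<Sum>K'\<in>\<T>. if K' = K then poly (pderiv (p K)) y else 0)"
      using division_ofD(5)[OF div] K by (intro sum.cong) (auto simp: indicator_def)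
    also have "\<dots> = poly (pderiv (p K)) y" using K division_ofD(1)[OF div] by simp
    also have "\<dots> = deriv u y"
      using DERIV_imp_deriv[OF fe_space_DERIV_poly[OF K(2) p[OF K(1)]]] by simp
    finally show ?thesis .
  qed
  ultimately show ?thesis by (rule L2_on_cong_finite[OF finite_mesh_nodes[OF assms(1)], rotated -1])
qed

lemma fe_space_deriv_lincomb:
  assumes "mesh \<T> h" "u \<in> fe_space \<T> k" "v \<in> fe_space \<T> k" "y \<in> {0<..<1} - mesh_nodes \<T>"
  shows "deriv (\<lambda>x. u x + c * v x) y = deriv u y + c * deriv v y"
  by (intro DERIV_imp_deriv DERIV_add DERIV_cmult fe_space_DERIV[OF assms(1,2,4)]
      fe_space_DERIV[OF assms(1,3,4)])

text \<open>The function \<open>(p + q * y) * u^2 / 2\<close> has derivative \<open>?f'\<close> off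
  the nodes and vanishes at both end points with \<open>u\<close>. Its continuity suffices to carry
  the fundamental theorem of calculus across the nodes.\<close>

lemma fe_space_drift:
  assumes "mesh \<T> h" "u \<in> fe_space \<T> k"
  shows "inner_L2 (\<lambda>y. (p + q * y) * deriv u y) u = - (q / 2) * inner_L2 u u"
proof -
  have u: "unit_L2 u" and bu': "unit_L2 (\<lambda>y. (p + q * y) * deriv u y)"
    by (intro fe_space_L2[OF assms(2)] L2_on_continuous_mult continuous_intros
        fe_space_deriv_L2[OF assms])+
  let ?f' = "\<lambda>y. ((p + q * y) * deriv u y) * u y + q / 2 * (u y * u y)"
  have "(?f' has_integral ((p + q * 1) * (u 1)\<^sup>2 / 2 - (p + q * 0) * (u 0)\<^sup>2 / 2)) {0..1}"
  proof (rule fundamental_theorem_of_calculus_interior_strong[OF finite_mesh_nodes[OF assms(1)]])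
    show "continuous_on {0..1} (\<lambda>y. (p + q * y) * (u y)\<^sup>2 / 2)"
      using assms by (intro continuous_intros fe_space_continuous) auto
    fix y assume "y \<in> {0<..<1} - mesh_nodes \<T>"
    note [derivative_intros] = fe_space_DERIV[OF assms this]
    show "((\<lambda>y. (p + q * y) * (u y)\<^sup>2 / 2) has_vector_derivative ?f' y) (at y)"
      unfolding has_real_derivative_iff_has_vector_derivative[symmetric]
      by (auto intro!: derivative_eq_intros simp: field_simps power2_eq_square)
  qed simp
  moreover have "u 0 = 0" "u 1 = 0" using assms by (auto simp: fe_space_def)
  ultimately have "integral {0<..<1} ?f' = 0"
    using integral_open_interval_real[of 0 1 ?f'] by (simp add: integral_unique)
  \<comment> \<open>The fundamental theorem speaks of the gauge integral; Lebesgue integrability of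
    both summands identifies it with the Lebesgue integral.\<close>
  moreover have int: "set_integrable lebesgue {0<..<1} (\<lambda>y. ((p + q * y) * deriv u y) * u y)"
    "set_integrable lebesgue {0<..<1} (\<lambda>y. q / 2 * (u y * u y))"
    by (intro set_integrable_mult_right L2_on_mult u bu')+
  ultimately have "(LINT y:{0<..<1}|lebesgue. ?f' y) = 0"
    using set_lebesgue_integral_eq_integral(2)[OF set_integral_add(1)[OF int]] by simp
  also have "(LINT y:{0<..<1}|lebesgue. ?f' y) = inner_L2 (\<lambda>y. (p + q * y) * deriv u y) u + q / 2 * inner_L2 u u"
    using set_integral_add(2)[OF int] by (simp add: inner_L2_def)
  finally show ?thesis by simp
qed

section \<open>The backward Euler problem with a frozen diffusion coefficient\<close>

definition euler_form ::
  "real \<Rightarrow> real \<Rightarrow> real \<Rightarrow> real \<Rightarrow> real \<Rightarrow> (real \<Rightarrow> real) \<Rightarrow> (real \<Rightarrow> real) \<Rightarrow> real" where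
  "euler_form \<delta> p q \<kappa> c u w = inner_L2 u w / \<delta> + \<kappa> * c * inner_L2 (deriv u) (deriv w)
     - inner_L2 (\<lambda>y. (p + q * y) * deriv u y) w"

context
  fixes \<T> :: "real set set" and h \<delta> p q \<kappa> :: real and k :: nat
  assumes mesh: "mesh \<T> h" and \<delta>: "\<delta> > 0" and q: "q \<ge> 0" and \<kappa>: "\<kappa> > 0"
begin

lemma fe_space_lincomb:
  "u \<in> fe_space \<T> k \<Longrightarrow> v \<in> fe_space \<T> k \<Longrightarrow> (\<lambda>y. u y + c * v y) \<in> fe_space \<T> k"
  by (rule fun_subspaceD(2)[OF fun_subspace_fe_space])

lemma fe_space_drift_L2: "u \<in> fe_space \<T> k \<Longrightarrow> unit_L2 (\<lambda>y. (p + q * y) * deriv u y)"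
  by (intro L2_on_continuous_mult fe_space_deriv_L2[OF mesh] continuous_intros)

text \<open>At the nodes \<open>deriv\<close> need not be additive, so linearity is recovered only
  under the integral.\<close>

lemma inner_L2_deriv_lincomb:
  assumes "u \<in> fe_space \<T> k" "v \<in> fe_space \<T> k" "unit_L2 w"
  shows "inner_L2 (deriv (\<lambda>y. u y + c * v y)) w
    = inner_L2 (deriv u) w + c * inner_L2 (deriv v) w"
proof -
  have "inner_L2 (deriv (\<lambda>y. u y + c * v y)) w = inner_L2 (\<lambda>y. deriv u y + c * deriv v y) w"
    by (rule inner_L2_cong_finite[OF finite_mesh_nodes[OF mesh]])
      (rule fe_space_deriv_lincomb[OF mesh assms(1,2)])
  then show ?thesis
    using inner_L2_lincomb_left[OF fe_space_deriv_L2[OF mesh assms(1)]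
        fe_space_deriv_L2[OF mesh assms(2)] assms(3)] by simp
qed

lemma inner_L2_drift_lincomb:
  assumes "u \<in> fe_space \<T> k" "v \<in> fe_space \<T> k" "unit_L2 w"
  shows "inner_L2 (\<lambda>y. (p + q * y) * deriv (\<lambda>y. u y + c * v y) y) w
    = inner_L2 (\<lambda>y. (p + q * y) * deriv u y) w + c * inner_L2 (\<lambda>y. (p + q * y) * deriv v y) w"
proof -
  have "inner_L2 (\<lambda>y. (p + q * y) * deriv (\<lambda>y. u y + c * v y) y) w
    = inner_L2 (\<lambda>y. (p + q * y) * deriv u y + c * ((p + q * y) * deriv v y)) w"
    by (rule inner_L2_cong_finite[OF finite_mesh_nodes[OF mesh]])
      (simp only: fe_space_deriv_lincomb[OF mesh assms(1,2)] distrib_left mult.left_commute)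
  then show ?thesis
    using inner_L2_lincomb_left[OF fe_space_drift_L2[OF assms(1)] fe_space_drift_L2[OF assms(2)] assms(3)]
    by simp
qed

lemma euler_form_lincomb_left:
  assumes w: "w \<in> fe_space \<T> k"
  shows "linear_on_fun (fe_space \<T> k) (\<lambda>u. euler_form \<delta> p q \<kappa> c u w)"
  unfolding linear_on_fun_def
proof (intro ballI allI)
  fix u v d assume u: "u \<in> fe_space \<T> k" and v: "v \<in> fe_space \<T> k"
  have arith: "(a + d * a') / \<delta> + \<kappa> * c * (b + d * b') - (e + d * e')
    = a / \<delta> + \<kappa> * c * b - e + d * (a' / \<delta> + \<kappa> * c * b' - e')" for a a' b b' e e' :: real
    by (simp add: add_divide_distrib algebra_simps)
  show "euler_form \<delta> p q \<kappa> c (\<lambda>x. u x + d * v x) w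
    = euler_form \<delta> p q \<kappa> c u w + d * euler_form \<delta> p q \<kappa> c v w"
    unfolding euler_form_def inner_L2_lincomb_left[OF fe_space_L2[OF u] fe_space_L2[OF v] fe_space_L2[OF w]]
      inner_L2_deriv_lincomb[OF u v fe_space_deriv_L2[OF mesh w]]
      inner_L2_drift_lincomb[OF u v fe_space_L2[OF w]]
    by (rule arith)
qed

lemma euler_form_lincomb_right:
  assumes w: "w \<in> fe_space \<T> k"
  shows "linear_on_fun (fe_space \<T> k) (euler_form \<delta> p q \<kappa> c w)"
  unfolding linear_on_fun_def
proof (intro ballI allI)
  fix u v d assume u: "u \<in> fe_space \<T> k" and v: "v \<in> fe_space \<T> k"
  have arith: "(a + d * a') / \<delta> + \<kappa> * c * (b + d * b') - (e + d * e')
    = a / \<delta> + \<kappa> * c * b - e + d * (a' / \<delta> + \<kappa> * c * b' - e')" for a a' b b' e e' :: real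
    by (simp add: add_divide_distrib algebra_simps)
  show "euler_form \<delta> p q \<kappa> c w (\<lambda>x. u x + d * v x)
    = euler_form \<delta> p q \<kappa> c w u + d * euler_form \<delta> p q \<kappa> c w v"
    unfolding euler_form_def inner_L2_commute[of "deriv w"]
      inner_L2_lincomb_right[OF fe_space_L2[OF u] fe_space_L2[OF v] fe_space_L2[OF w]]
      inner_L2_lincomb_right[OF fe_space_L2[OF u] fe_space_L2[OF v] fe_space_drift_L2[OF w]]
      inner_L2_deriv_lincomb[OF u v fe_space_deriv_L2[OF mesh w]]
    by (rule arith)
qed

lemma euler_form_self:
  assumes "u \<in> fe_space \<T> k"
  shows "euler_form \<delta> p q \<kappa> c u u
    = inner_L2 u u / \<delta> + \<kappa> * c * inner_L2 (deriv u) (deriv u) + q / 2 * inner_L2 u u"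
  unfolding euler_form_def fe_space_drift[OF mesh assms] by simp

text \<open>The form is affine in the coefficient: a solution for \<open>d\<close> solves the
  problem for \<open>c\<close> up to this explicit residual.\<close>

lemma euler_form_change_coefficient:
  "euler_form \<delta> p q \<kappa> c u w
    = euler_form \<delta> p q \<kappa> d u w + \<kappa> * (c - d) * inner_L2 (deriv u) (deriv w)"
  unfolding euler_form_def by (simp add: algebra_simps)

lemma euler_form_coercive:
  assumes "u \<in> fe_space \<T> k" "c > 0" "u \<noteq> (\<lambda>_. 0)"
  shows "euler_form \<delta> p q \<kappa> c u u > 0"
proof -
  have "inner_L2 u u \<noteq> 0"
  proof
    assume "inner_L2 u u = 0"
    \<comment> \<open>Being the zero function also concerns points outside the unit interval, where
      extension by zero gives the value.\<close>
    from inner_L2_self_eq_0[OF fe_space_continuous[OF assms(1)] this] assms(1) have "u y = 0" for y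
      by (cases "y \<in> {0..1}") (auto simp: fe_space_def)
    with assms(3) show False by auto
  qed
  then have "inner_L2 u u > 0" using inner_L2_nonneg[of u] by linarith
  then show ?thesis
    unfolding euler_form_self[OF assms(1)] using \<delta> q \<kappa> assms(2) inner_L2_nonneg[of "deriv u"]
    by (intro add_pos_nonneg) auto
qed

lemma euler_form_solvable:
  assumes "c > 0" and F: "linear_on_fun (fe_space \<T> k) F"
  shows "\<exists>u\<in>fe_space \<T> k. \<forall>w\<in>fe_space \<T> k. euler_form \<delta> p q \<kappa> c u w = F w"
proof -
  obtain P where "finite P"
    "\<And>u. u \<in> fe_space \<T> k \<Longrightarrow> (\<And>y. y \<in> P \<Longrightarrow> u y = 0) \<Longrightarrow> u = (\<lambda>_. 0)"
    using fe_space_separating_points[OF mesh] by blast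
  from galerkin_solvable[OF this(1) fun_subspace_fe_space this(2) euler_form_lincomb_left
      euler_form_lincomb_right euler_form_coercive F]
  show ?thesis using assms(1) by blast
qed

text \<open>The difference \<open>D\<close> is tested with itself. Its energy equals the residual
  from the change of coefficient; Young's inequality absorbs the derivative of \<open>D\<close> into
  the diffusion term and leaves the norm of \<open>deriv v\<close>. The resulting constant depends
  on \<open>v\<close>, but not on \<open>u\<close> or \<open>c\<close>.\<close>

lemma euler_solution_lipschitz:
  assumes u: "u \<in> fe_space \<T> k" "\<And>w. w \<in> fe_space \<T> k \<Longrightarrow> euler_form \<delta> p q \<kappa> c u w = F w"
    and v: "v \<in> fe_space \<T> k" "\<And>w. w \<in> fe_space \<T> k \<Longrightarrow> euler_form \<delta> p q \<kappa> d v w = F w"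
    and m: "m > 0" "c \<ge> m"
  shows "(inner_L2 u (\<lambda>_. 1) - inner_L2 v (\<lambda>_. 1))\<^sup>2
    \<le> \<delta> * \<kappa> / (4 * m) * inner_L2 (deriv v) (deriv v) * (c - d)\<^sup>2"
proof -
  define D where "D = (\<lambda>y. u y + (-1) * v y)"
  have D: "D \<in> fe_space \<T> k" unfolding D_def by (rule fe_space_lincomb[OF u(1) v(1)])
  have one: "unit_L2 (\<lambda>_. 1)" by (rule L2_on_continuous) simp
  let ?X = "inner_L2 (deriv D) (deriv D)" and ?Y = "inner_L2 (deriv v) (deriv v)"
    and ?Z = "inner_L2 (deriv v) (deriv D)"
  have "euler_form \<delta> p q \<kappa> c D D = euler_form \<delta> p q \<kappa> c u D + (-1) * euler_form \<delta> p q \<kappa> c v D"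
    using linear_on_funD[OF euler_form_lincomb_left[OF D] u(1) v(1)] unfolding D_def .
  \<comment> \<open>Both solutions have the right-hand side \<open>F D\<close>, which cancels; only
    the residual of \<open>v\<close> remains.\<close>
  also have "\<dots> = - \<kappa> * (c - d) * ?Z"
    unfolding euler_form_change_coefficient[of c v D d] u(2)[OF D] v(2)[OF D] by simp
  finally have energy: "inner_L2 D D / \<delta> + \<kappa> * c * ?X + q / 2 * inner_L2 D D = - \<kappa> * (c - d) * ?Z"
    unfolding euler_form_self[OF D] .
  have c: "c > 0" using m by linarith
  \<comment> \<open>Young's inequality: the norm of \<open>D' + (c - d)/(2c) v'\<close> is nonnegative.\<close>
  have "0 \<le> ?X + 2 * ((c - d) / (2 * c)) * ?Z + ((c - d) / (2 * c))\<^sup>2 * ?Y"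
    using inner_L2_lincomb_self[OF fe_space_deriv_L2[OF mesh D] fe_space_deriv_L2[OF mesh v(1)]]
      inner_L2_nonneg inner_L2_commute by metis
  then have "0 \<le> \<kappa> * c * (?X + 2 * ((c - d) / (2 * c)) * ?Z + ((c - d) / (2 * c))\<^sup>2 * ?Y)"
    using \<kappa> c by simp
  also have "\<dots> = \<kappa> * c * ?X + \<kappa> * (c - d) * ?Z + \<kappa> * (c - d)\<^sup>2 / (4 * c) * ?Y"
    using c by (simp add: field_simps power2_eq_square)
  finally have young: "- \<kappa> * (c - d) * ?Z \<le> \<kappa> * c * ?X + \<kappa> * (c - d)\<^sup>2 / (4 * c) * ?Y"
    by simp
  \<comment> \<open>Passing from \<open>c\<close> to its lower bound \<open>m\<close> makes the
    constant uniform in \<open>c\<close>.\<close>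
  have "\<kappa> * (c - d)\<^sup>2 / (4 * c) * ?Y \<le> \<kappa> * (c - d)\<^sup>2 / (4 * m) * ?Y"
    using m c \<kappa> inner_L2_nonneg[of "deriv v"]
    by (intro mult_right_mono divide_left_mono mult_nonneg_nonneg) auto
  moreover have "q / 2 * inner_L2 D D \<ge> 0" using q inner_L2_nonneg[of D] by simp
  ultimately have "inner_L2 D D / \<delta> \<le> \<kappa> * (c - d)\<^sup>2 / (4 * m) * ?Y"
    using energy young by linarith
  then have "inner_L2 D D \<le> \<delta> * \<kappa> / (4 * m) * ?Y * (c - d)\<^sup>2"
    using \<delta> by (simp add: field_simps)
  moreover have "inner_L2 D (\<lambda>_. 1) = inner_L2 u (\<lambda>_. 1) - inner_L2 v (\<lambda>_. 1)"
    using inner_L2_lincomb_left[OF fe_space_L2[OF u(1)] fe_space_L2[OF v(1)] one, of "-1"]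
    unfolding D_def by simp
  ultimately show ?thesis using inner_L2_one_square_le[OF fe_space_L2[OF D]] by simp
qed

lemma euler_solution_mean_continuous:
  assumes m: "m > 0"
    and U: "\<And>c. c \<in> {m..M} \<Longrightarrow> U c \<in> fe_space \<T> k"
    and sol: "\<And>c w. c \<in> {m..M} \<Longrightarrow> w \<in> fe_space \<T> k \<Longrightarrow> euler_form \<delta> p q \<kappa> c (U c) w = F w"
  shows "continuous_on {m..M} (\<lambda>c. inner_L2 (U c) (\<lambda>_. 1))"
  unfolding continuous_on_def
proof
  fix d assume d: "d \<in> {m..M}"
  let ?\<phi> = "\<lambda>c. inner_L2 (U c) (\<lambda>_. 1)"
  \<comment> \<open>The square root of the constant in \<open>euler_solution_lipschitz\<close> with
    \<open>v = U d\<close>. It varies with \<open>d\<close> but not with \<open>c\<close>, which is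
    enough for continuity at \<open>d\<close>.\<close>
  define C where "C = sqrt (\<delta> * \<kappa> / (4 * m) * inner_L2 (deriv (U d)) (deriv (U d)))"
  have "\<bar>?\<phi> c - ?\<phi> d\<bar> \<le> C * \<bar>c - d\<bar>" if c: "c \<in> {m..M}" for c
  proof -
    have "(?\<phi> c - ?\<phi> d)\<^sup>2 \<le> \<delta> * \<kappa> / (4 * m) * inner_L2 (deriv (U d)) (deriv (U d)) * (c - d)\<^sup>2"
      by (rule euler_solution_lipschitz[OF U[OF c] sol[OF c] U[OF d] sol[OF d] m]) (use c in auto)
    from real_sqrt_le_mono[OF this] show ?thesis
      by (simp only: C_def real_sqrt_mult real_sqrt_abs)
  qed
  then have "eventually (\<lambda>c. norm (?\<phi> c - ?\<phi> d) \<le> C * \<bar>c - d\<bar>) (at d within {m..M})"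
    by (auto simp: eventually_at_filter)
  moreover have "((\<lambda>c. C * \<bar>c - d\<bar>) \<longlongrightarrow> 0) (at d within {m..M})"
    by (auto intro!: tendsto_eq_intros)
  ultimately show "(?\<phi> \<longlongrightarrow> ?\<phi> d) (at d within {m..M})"
    by (rule LIM_zero_cancel[OF Lim_null_comparison])
qed

end

section \<open>The sign of the time derivative of the width\<close>

text \<open>The last time level is \<open>t = T\<close>, which monotonicity on the half-open
  interval does not reach; a limit from the left closes the gap.\<close>

lemma mono_on_Icc_of_Ico:
  fixes f :: "real \<Rightarrow> real"
  assumes "mono_on {a..<b} f" "continuous_on {a..b} f"
  shows "mono_on {a..b} f"
proof (rule mono_onI)
  fix r s assume rs: "r \<in> {a..b}" "s \<in> {a..b}" "r \<le> s"
  show "f r \<le> f s"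
  proof (cases "s < b \<or> r = s")
    case True
    then show ?thesis using rs assms(1) by (auto simp: mono_on_def)
  next
    case False
    then have b: "s = b" "r < b" using rs by auto
    have "(f \<longlongrightarrow> f b) (at b within {a..b})"
      using assms(2) rs by (auto simp: continuous_on_def)
    then have "(f \<longlongrightarrow> f b) (at b within {r<..<b})"
      by (rule tendsto_within_subset) (use rs in auto)
    moreover have "eventually (\<lambda>x. f r \<le> f x) (at b within {r<..<b})"
      using rs b assms(1) by (auto simp: eventually_at_filter mono_on_def)
    moreover have "at b within {r<..<b} \<noteq> bot"
      using b by (simp add: trivial_limit_within islimpt_greaterThanLessThan2)
    ultimately show ?thesis using b tendsto_lowerbound by blast
  qed
qed

lemma C2_on_time_deriv:
  assumes "C2_on {0..T} u" "t \<in> {0..T}" "T > 0"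
  shows "(u has_real_derivative time_deriv T u t) (at t within {0..T})"
proof -
  obtain D where D: "(u has_real_derivative D) (at t within {0..T})"
    using assms unfolding C2_on_def by blast
  then have "vector_derivative u (at t within {0..T}) = D"
    using assms by (intro vector_derivative_within)
      (auto simp: has_real_derivative_iff_has_vector_derivative trivial_limit_within islimpt_Icc)
  then show ?thesis using D by (simp add: time_deriv_def)
qed

text \<open>A negative derivative at \<open>t\<close> would make the width larger just to the left
  of \<open>t\<close>, against monotonicity. Looking to the left is possible at every positive time,
  including \<open>T\<close>.\<close>

lemma time_deriv_nonneg:
  assumes "C2_on {0..T} \<alpha>" "C2_on {0..T} \<beta>" "mono_on {0..<T} (\<lambda>t. \<beta> t - \<alpha> t)"
    and t: "0 < t" "t \<le> T"
  shows "time_deriv T (\<lambda>t. \<beta> t - \<alpha> t) t \<ge> 0"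
proof (rule ccontr)
  let ?\<gamma> = "\<lambda>t. \<beta> t - \<alpha> t"
  have T: "T > 0" using t by simp
  have diff: "(?\<gamma> has_real_derivative time_deriv T \<beta> s - time_deriv T \<alpha> s) (at s within {0..T})"
    if "s \<in> {0..T}" for s
    by (intro DERIV_diff C2_on_time_deriv assms that T)
  then have cont: "continuous_on {0..T} ?\<gamma>" by (rule DERIV_continuous_on)
  have mono: "mono_on {0..T} ?\<gamma>" by (rule mono_on_Icc_of_Ico[OF assms(3) cont])
  have "time_deriv T ?\<gamma> t = time_deriv T \<beta> t - time_deriv T \<alpha> t"
    unfolding time_deriv_def[of T ?\<gamma>] using diff[of t] t by (intro vector_derivative_within)
      (auto simp: has_real_derivative_iff_has_vector_derivative trivial_limit_within islimpt_Icc)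
  moreover assume "\<not> time_deriv T ?\<gamma> t \<ge> 0"
  ultimately obtain d where d: "d > 0"
    "\<And>h. h > 0 \<Longrightarrow> t - h \<in> {0..T} \<Longrightarrow> h < d \<Longrightarrow> ?\<gamma> t < ?\<gamma> (t - h)"
    using has_real_derivative_neg_dec_left[OF diff[of t]] t by auto
  define h where "h = min t (d / 2)"
  have h: "h > 0" "t - h \<in> {0..T}" "h < d" using d(1) t by (auto simp: h_def)
  from d(2)[OF this] mono_onD[OF mono h(2), of t] h t show False by auto
qed

section \<open>The fixed point for the nonlocal values and the conclusion\<close>

lemma nonlocal_l_eq: "nonlocal_l \<gamma> t w = \<gamma> t * inner_L2 w (\<lambda>_. 1)"
proof -
  have "(LINT y:{0..1}|lebesgue. w y) = (LINT y:{0<..<1}|lebesgue. w y * 1)"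
    by (rule set_lebesgue_integral_cong_finite[of "{0, 1}"]) (auto simp: indicator_def)
  then show ?thesis by (simp add: nonlocal_l_def inner_L2_def)
qed

text \<open>Here \<open>\<phi> i c\<close> will be the nonlocal value of the \<open>i\<close>-th
  solution with frozen coefficient \<open>c\<close>. The box has the bounds of the
  \<open>\<phi> i\<close> on \<open>{m..M}\<close> as half-widths, so the map sends every
  \<open>s\<close> into it.\<close>

lemma coefficient_fixed_point:
  fixes a :: "'n::finite \<Rightarrow> real ^ 'n \<Rightarrow> real" and \<phi> :: "'n \<Rightarrow> real \<Rightarrow> real"
  assumes "\<And>i. continuous_on UNIV (a i)" "\<And>i s. a i s \<in> {m..M}"
    and "\<And>i. continuous_on {m..M} (\<phi> i)"
  obtains s where "s = (\<chi> i. \<phi> i (a i s))"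
proof -
  have "\<exists>C. \<forall>c\<in>{m..M}. \<bar>\<phi> i c\<bar> \<le> C" for i
    using compact_imp_bounded[OF compact_continuous_image[OF assms(3) compact_Icc]]
    by (auto simp: bounded_iff)
  then obtain C where C: "\<And>i c. c \<in> {m..M} \<Longrightarrow> \<bar>\<phi> i c\<bar> \<le> C i" by metis
  let ?G = "\<lambda>s. \<chi> i. \<phi> i (a i s)" and ?S = "cbox (\<chi> i. - C i) (\<chi> i. C i)"
  have G: "?G s \<in> ?S" for s
    using C[OF assms(2)] by (auto simp: mem_box_cart abs_le_iff minus_le_iff)
  have "continuous_on ?S ?G"
    by (intro continuous_on_vec_lambda continuous_on_compose2[OF assms(3)]
        continuous_on_subset[OF assms(1)]) (use assms(2) in auto)
  moreover have "?S \<noteq> {}" "?G \<in> ?S \<rightarrow> ?S" using G by blast+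
  ultimately obtain s where "?G s = s"
    using brouwer[OF compact_cbox convex_box(1)] by blast
  from that[OF this[symmetric]] show ?thesis .
qed

theorem theorem6:
  fixes \<alpha> \<beta> \<gamma> :: "real \<Rightarrow> real"
    and T \<gamma>0 \<gamma>1 \<gamma>'max \<alpha>'max m\<^sub>a M\<^sub>a \<delta> h :: real
    and f :: "'n::finite \<Rightarrow> real \<Rightarrow> real \<Rightarrow> real"
    and a :: "'n \<Rightarrow> real ^ 'n \<Rightarrow> real"
    and N k n :: nat
    and \<T> :: "real set set"
    and V :: "'n \<Rightarrow> real \<Rightarrow> real"
  assumes T: "T > 0"
    and C2: "C2_on {0..T} \<alpha>" "C2_on {0..T} \<beta>"
    and L2: "L2_on {0<..<T} (time_deriv T \<alpha>)" "L2_on {0<..<T} (time_deriv T \<beta>)"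
    and \<gamma>: "\<gamma> = (\<lambda>t. \<beta> t - \<alpha> t)"
    and \<gamma>_mono: "mono_on {0..<T} \<gamma>"
    and \<gamma>_bounds: "0 < \<gamma>0" "\<And>t. t \<in> {0..T} \<Longrightarrow> \<gamma>0 < \<gamma> t \<and> \<gamma> t < \<gamma>1"
    and deriv_bounds: "\<And>t. t \<in> {0..T} \<Longrightarrow> \<bar>time_deriv T \<gamma> t\<bar> \<le> \<gamma>'max"
      "\<And>t. t \<in> {0..T} \<Longrightarrow> \<bar>time_deriv T \<alpha> t\<bar> \<le> \<alpha>'max"
    and f_meas: "\<And>i. set_borel_measurable lebesgue
        {(x, t). 0 < t \<and> t < T \<and> \<alpha> t < x \<and> x < \<beta> t} (\<lambda>(x, t). f i x t)"
    and f_int: "\<And>i. (\<integral>\<^sup>+ t\<in>{0<..<T}. (\<integral>\<^sup>+ x\<in>{\<alpha> t<..<\<beta> t}.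
        ennreal ((f i x t)\<^sup>2) \<partial>lebesgue) \<partial>lebesgue) < \<infinity>"
    and a_lipschitz: "\<And>i. \<exists>L. L-lipschitz_on UNIV (a i)"
    and a_bounds: "0 < m\<^sub>a" "\<And>i s. m\<^sub>a \<le> a i s \<and> a i s \<le> M\<^sub>a"
    and time_step: "\<delta> > 0" "T = real N * \<delta>"
    and g_L2: "\<And>i m. m \<le> N \<Longrightarrow> L2_on {0<..<1} (\<lambda>y. pull_back \<alpha> \<gamma> (f i) y (real m * \<delta>))"
    and mesh: "mesh \<T> h"
    and k: "k \<ge> 1"
    and n: "n < N"
    and V: "\<And>i. V i \<in> fe_space \<T> k"
  shows "\<exists>V' :: 'n \<Rightarrow> real \<Rightarrow> real. (\<forall>i. V' i \<in> fe_space \<T> k) \<and>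
    (let t = real (n + 1) * \<delta> in
      \<forall>i. \<forall>W \<in> fe_space \<T> k.
        inner_L2 (\<lambda>y. (V' i y - V i y) / \<delta>) W
        + b2 \<gamma> t * a i (\<chi> j. nonlocal_l \<gamma> t (V' j)) * inner_L2 (deriv (V' i)) (deriv W)
        - inner_L2 (\<lambda>y. b1 T \<alpha> \<gamma> y t * deriv (V' i) y) W
        = inner_L2 (\<lambda>y. pull_back \<alpha> \<gamma> (f i) y t) W)"
proof -
  define t where "t = real (n + 1) * \<delta>"
  have "real (n + 1) \<le> real N" using n by simp
  \<comment> \<open>The new level is positive and, since \<open>n + 1\<close> is at most
    \<open>N\<close>, does not exceed \<open>T\<close>, as \<open>time_deriv_nonneg\<close>
    requires.\<close>
  then have t: "0 < t" "t \<le> T" using time_step by (auto simp: t_def)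
  have \<gamma>_pos: "\<gamma> t > 0" using \<gamma>_bounds(1) \<gamma>_bounds(2)[of t] t by auto
  define p where "p = time_deriv T \<alpha> t / \<gamma> t"
  define q where "q = time_deriv T \<gamma> t / \<gamma> t"
  have q: "q \<ge> 0"
    unfolding q_def using time_deriv_nonneg[OF C2 _ t] \<gamma>_mono \<gamma>_pos unfolding \<gamma> by simp
  have b1: "b1 T \<alpha> \<gamma> y t = p + q * y" for y
    by (simp add: b1_def p_def q_def add_divide_distrib)
  have \<kappa>: "b2 \<gamma> t > 0" using \<gamma>_pos by (simp add: b2_def)
  note ctx = mesh time_step(1) q \<kappa>
  let ?S = "fe_space \<T> k" and ?B = "euler_form \<delta> p q (b2 \<gamma> t)"
  \<comment> \<open>The load together with the contribution of the previous time level, moved to the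
    right-hand side. It does not involve the unknown coefficients.\<close>
  define F where "F = (\<lambda>i w. inner_L2 (\<lambda>y. pull_back \<alpha> \<gamma> (f i) y t) w + inner_L2 (V i) w / \<delta>)"
  have g: "unit_L2 (\<lambda>y. pull_back \<alpha> \<gamma> (f i) y t)" for i
    unfolding t_def by (rule g_L2) (use n in simp)
  have F: "linear_on_fun ?S (F i)" for i
    unfolding linear_on_fun_def
  proof (intro ballI allI)
    fix u v c assume u: "u \<in> ?S" and v: "v \<in> ?S"
    have arith: "a + c * a' + (b + c * b') / \<delta> = a + b / \<delta> + c * (a' + b' / \<delta>)" for a a' b b' :: real
      by (simp add: add_divide_distrib algebra_simps)
    show "F i (\<lambda>x. u x + c * v x) = F i u + c * F i v"
      unfolding F_def inner_L2_lincomb_right[OF fe_space_L2[OF u] fe_space_L2[OF v] g]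
        inner_L2_lincomb_right[OF fe_space_L2[OF u] fe_space_L2[OF v] fe_space_L2[OF V]]
      by (rule arith)
  qed
  \<comment> \<open>For each component the solution depends on the other components only through the
    scalar \<open>c\<close>; this is the decoupling.\<close>
  define U where "U = (\<lambda>i c. SOME u. u \<in> ?S \<and> (\<forall>w\<in>?S. ?B c u w = F i w))"
  have "U i c \<in> ?S \<and> (\<forall>w\<in>?S. ?B c (U i c) w = F i w)" if "c \<in> {m\<^sub>a..M\<^sub>a}" for c i
  proof -
    have "c > 0" using that a_bounds(1) by simp
    from someI_ex[OF euler_form_solvable[OF ctx this F, unfolded Bex_def]] show ?thesis
      unfolding U_def .
  qed
  then have U: "\<And>i c. c \<in> {m\<^sub>a..M\<^sub>a} \<Longrightarrow> U i c \<in> ?S"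
    and sol: "\<And>i c w. c \<in> {m\<^sub>a..M\<^sub>a} \<Longrightarrow> w \<in> ?S \<Longrightarrow> ?B c (U i c) w = F i w"
    by blast+
  have "continuous_on UNIV (a i)" for i
    using a_lipschitz lipschitz_on_continuous_on by blast
  moreover have a: "a i s \<in> {m\<^sub>a..M\<^sub>a}" for i s using a_bounds(2) by simp
  moreover have "continuous_on {m\<^sub>a..M\<^sub>a} (\<lambda>c. nonlocal_l \<gamma> t (U i c))" for i
    unfolding nonlocal_l_eq
    by (intro continuous_on_mult_left euler_solution_mean_continuous[OF ctx a_bounds(1) U sol])
  ultimately obtain s where s: "s = (\<chi> i. nonlocal_l \<gamma> t (U i (a i s)))"
    by (rule coefficient_fixed_point)
  \<comment> \<open>Since \<open>s\<close> is a fixed point, it is the vector of nonlocal values of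
    \<open>V'\<close>, so the coefficients frozen at \<open>s\<close> are those that the scheme
    prescribes for \<open>V'\<close>.\<close>
  define V' where "V' = (\<lambda>i. U i (a i s))"
  have V': "V' i \<in> ?S" for i unfolding V'_def by (rule U[OF a])
  have step: "inner_L2 (\<lambda>y. (V' i y - V i y) / \<delta>) W
        + b2 \<gamma> t * a i (\<chi> j. nonlocal_l \<gamma> t (V' j)) * inner_L2 (deriv (V' i)) (deriv W)
        - inner_L2 (\<lambda>y. b1 T \<alpha> \<gamma> y t * deriv (V' i) y) W
        = inner_L2 (\<lambda>y. pull_back \<alpha> \<gamma> (f i) y t) W" if W: "W \<in> ?S" for i W
  proof -
    have "inner_L2 (\<lambda>y. (V' i y - V i y) / \<delta>) W
      = (LINT y:{0<..<1}|lebesgue. (V' i y + (-1) * V i y) * W y / \<delta>)"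
      unfolding inner_L2_def by (simp only: times_divide_eq_left mult_minus1 diff_conv_add_uminus)
    also have "\<dots> = inner_L2 (\<lambda>y. V' i y + (-1) * V i y) W / \<delta>"
      unfolding inner_L2_def by (rule set_integral_divide_zero)
    also have "\<dots> = inner_L2 (V' i) W / \<delta> - inner_L2 (V i) W / \<delta>"
      unfolding inner_L2_lincomb_left[OF fe_space_L2[OF V'] fe_space_L2[OF V] fe_space_L2[OF W]]
      by (simp add: diff_divide_distrib)
    finally have "inner_L2 (\<lambda>y. (V' i y - V i y) / \<delta>) W = inner_L2 (V' i) W / \<delta> - inner_L2 (V i) W / \<delta>" .
    moreover have "?B (a i s) (V' i) W = F i W" unfolding V'_def by (rule sol[OF a W])
    moreover have "(\<chi> j. nonlocal_l \<gamma> t (V' j)) = s" unfolding V'_def by (rule s[symmetric])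
    ultimately show ?thesis by (simp add: euler_form_def F_def b1)
  qed
  show ?thesis
    unfolding Let_def t_def[symmetric] by (intro exI[of _ V'] conjI allI ballI V' step)
qed

end
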